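(* For all real numbers $x,y,r,a,b,q$ satisfying $0<q<1$, $0<a<b<1$, and $x\ge y\ge r\ge 0$, the $a,b;q$-numbers satisfy the inequality $$[x]_{aq^{2r},bq^r;q}\,[y]_{a,b;q}\ \ge\ [x+r]_{a,b;q}\,[y-r]_{aq^{2r},bq^r;q}.$$
   Context: For parameters $a,b,q$ the $a,b;q$-number of $x$ is defined by $$[x]_{a,b;q}:=\frac{(1-q^x)(1-aq^x)(1-bq)(1-aq/b)}{(1-q)(1-aq)(1-bq^x)(1-aq^x/b)},$$ and $[x]_{aq^{2r},bq^r;q}$ denotes the same expression with $a$ replaced by $aq^{2r}$ and $b$ replaced by $bq^r$. *)

theory Defs
  imports Complex_Main
begin

text \<open>
  The \<open>a,b;q\<close>-number of \<open>x\<close>. Real powers are taken with \<open>powr\<close>,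
  which is the usual power for a base \<open>q > 0\<close>.
\<close>

definition abq_number :: "real \<Rightarrow> real \<Rightarrow> real \<Rightarrow> real \<Rightarrow> real" where
  "abq_number a b q x =
     ((1 - q powr x) * (1 - a * q powr x) * (1 - b * q) * (1 - a * q / b)) /
     ((1 - q) * (1 - a * q) * (1 - b * q powr x) * (1 - a * q powr x / b))"

end

theory Submission
  imports Defs
begin

text \<open>
  With \<open>X = q\<^sup>x\<close>, \<open>Y = q\<^sup>y\<close>, \<open>R = q\<^sup>r\<close>, the \<open>x\<close>-dependent denominators on the two sides
  coincide, because \<open>(b R) X = b (X R)\<close>, \<open>(a R\<^sup>2 / (b R)) X = (a / b) (X R)\<close> and likewise for
  \<open>Y / R\<close>; so do the normalising factors. What remains is an inequality between products of four
  linear factors. Put \<open>W = Y / R\<close>. The two factors in \<open>X\<close> change by \<open>X (1 - R) (1 - a R)\<close> from left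
  to right, and the two in \<open>Y\<close> by \<open>- W (1 - R) (1 - a R)\<close>, which reduces the claim to
  \<open>X (1 - W) (1 - a R\<^sup>2 W) \<le> W (1 - X) (1 - a R\<^sup>2 X)\<close>, true since \<open>X \<le> W\<close>.
\<close>

lemma abq_numerator_ineq:
  fixes X W R a :: real
  assumes "0 < X" "X \<le> W" "W \<le> 1" "0 < R" "R \<le> 1" "0 \<le> a" "a \<le> 1"
  shows "(1 - X * R) * (1 - a * (X * R)) * ((1 - W) * (1 - a * R\<^sup>2 * W))
    \<le> (1 - X) * (1 - a * R\<^sup>2 * X) * ((1 - W * R) * (1 - a * (W * R)))"
proof -
  define c where "c = (1 - R) * (1 - a * R)"
  have aR: "a * R \<le> 1" "a * R\<^sup>2 \<le> 1"
    using assms by (simp_all add: mult_le_one power_le_one)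
  have c: "0 \<le> c"
    unfolding c_def using assms aR by simp
  have aRW: "a * R\<^sup>2 * W \<le> 1"
    using aR assms by (simp add: mult_le_one)
  have aRX: "a * R\<^sup>2 * X \<le> a * R\<^sup>2 * W"
    using assms by (intro mult_left_mono) auto
  \<comment> \<open>Each of the three factors grows when passing to the right-hand side.\<close>
  have "X * (1 - W) * (1 - a * R\<^sup>2 * W) \<le> W * (1 - X) * (1 - a * R\<^sup>2 * X)"
    using assms aRW aRX by (intro mult_mono) (auto simp: algebra_simps)
  then have "0 \<le> c * (W * (1 - X) * (1 - a * R\<^sup>2 * X) - X * (1 - W) * (1 - a * R\<^sup>2 * W))"
    using c by simp
  \<comment> \<open>With P, Q the shifted factors in \<open>X\<close>, \<open>W\<close>, this is P
    (Q + c W) - (P + c X) Q: the product P Q cancels.\<close>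
  also have "\<dots> = (1 - X) * (1 - a * R\<^sup>2 * X) * ((1 - W * R) * (1 - a * (W * R)))
      - (1 - X * R) * (1 - a * (X * R)) * ((1 - W) * (1 - a * R\<^sup>2 * W))"
    unfolding c_def by algebra
  finally show ?thesis by simp
qed

theorem theorem7:
  fixes x y r a b q :: real
  assumes "0 < q" and "q < 1"
    and "0 < a" and "a < b" and "b < 1"
    and "x \<ge> y" and "y \<ge> r" and "r \<ge> 0"
  shows "abq_number (a * q powr (2 * r)) (b * q powr r) q x * abq_number a b q y
    \<ge> abq_number a b q (x + r) * abq_number (a * q powr (2 * r)) (b * q powr r) q (y - r)"
proof -
  define X where "X = q powr x"
  define R where "R = q powr r"
  define W where "W = q powr (y - r)"
  have pos: "0 < X" "0 < R" "0 < W"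
    using assms by (simp_all add: X_def R_def W_def)
  have R2: "q powr (2 * r) = R\<^sup>2"
    by (simp add: R_def power2_eq_square flip: powr_add)
  have XR: "q powr (x + r) = X * R"
    by (simp add: X_def R_def powr_add)
  have WR: "q powr y = W * R"
    by (simp add: W_def R_def flip: powr_add)
  have "R \<le> 1" "W \<le> 1" "X \<le> W"
    using assms by (auto simp: X_def R_def W_def powr_le1 intro!: powr_mono')
  note le = this
  \<comment> \<open>\<open>K\<close> gathers the normalising factors and \<open>D\<close> the
    remaining denominators; both sides share \<open>K / D\<close>.\<close>
  define K where "K = (1 - b * R * q) * (1 - a * R\<^sup>2 * q / (b * R)) / ((1 - q) * (1 - a * R\<^sup>2 * q))
    * ((1 - b * q) * (1 - a * q / b) / ((1 - q) * (1 - a * q)))"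
  define D where "D = (1 - b * (X * R)) * (1 - a * (X * R) / b)
    * ((1 - b * (W * R)) * (1 - a * (W * R) / b))"
  have prod_le: "c * t \<le> 1" if "0 \<le> c" "c \<le> 1" "0 \<le> t" "t \<le> 1" for c t :: real
    using that by (intro mult_le_one)
  have ab: "0 < a / b" "a / b \<le> 1" "0 < b"
    using assms by auto
  have unit: "0 \<le> X * R" "X * R \<le> 1" "0 \<le> W * R" "W * R \<le> 1"
    "0 \<le> R * q" "R * q \<le> 1" "0 \<le> R\<^sup>2 * q" "R\<^sup>2 * q \<le> 1"
    using pos le assms by (simp_all add: mult_le_one power_le_one)
  have cancel: "a * R\<^sup>2 * t / (b * R) = a / b * (R * t)" for t
    using pos by (simp add: power2_eq_square)
  \<comment> \<open>Every factor of \<open>K\<close> and \<open>D\<close> is 1 minus a product of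
    numbers in [0,1].\<close>
  have K: "0 \<le> K"
    unfolding K_def cancel
    using assms ab unit
      prod_le[of b "R * q"] prod_le[of "a / b" "R * q"] prod_le[of a "R\<^sup>2 * q"]
      prod_le[of b q] prod_le[of "a / b" q] prod_le[of a q]
    by (intro mult_nonneg_nonneg divide_nonneg_nonneg) (simp_all add: mult.assoc)
  have D: "0 \<le> D"
    unfolding D_def
    using assms ab unit
      prod_le[of b "X * R"] prod_le[of "a / b" "X * R"]
      prod_le[of b "W * R"] prod_le[of "a / b" "W * R"]
    by (intro mult_nonneg_nonneg) simp_all
  have lhs: "abq_number (a * q powr (2 * r)) (b * q powr r) q x * abq_number a b q y
    = K / D * ((1 - X) * (1 - a * R\<^sup>2 * X) * ((1 - W * R) * (1 - a * (W * R))))"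
    unfolding abq_number_def R2 WR X_def[symmetric] R_def[symmetric] K_def D_def cancel
    by (simp add: mult_ac)
  have rhs: "abq_number a b q (x + r) * abq_number (a * q powr (2 * r)) (b * q powr r) q (y - r)
    = K / D * ((1 - X * R) * (1 - a * (X * R)) * ((1 - W) * (1 - a * R\<^sup>2 * W)))"
    unfolding abq_number_def R2 XR W_def[symmetric] R_def[symmetric] K_def D_def cancel
    by (simp add: mult_ac)
  show ?thesis
    unfolding lhs rhs
    using K D pos le assms by (intro mult_left_mono abq_numerator_ineq) auto
qed

end
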